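(* Let $d>2$. (Spherical version) If $\mathbf{P}$ is an arbitrary convex polytope in $\mathbb{S}^d$, then there exist $\mathbf{x}\in\operatorname{int}\mathbf{P}$ and $d+1$ open hemispheres of $\mathbb{S}^d$ whose boundaries contain $\mathbf{x}$ such that every exposed face of $\mathbf{P}$ is contained in at least one of the open hemispheres. (Euclidean version) If $\mathbf{P}$ is an arbitrary convex polytope in $\mathbb{E}^d$, then there exist $\mathbf{x}\in\operatorname{int}\mathbf{P}$ and $d+1$ open halfspaces of $\mathbb{E}^d$ whose boundaries contain $\mathbf{x}$ such that every exposed face of $\mathbf{P}$ is contained in at least one of the open halfspaces.
   Context: $\mathbb{S}^d$ denotes the unit sphere of Euclidean space $\mathbb{E}^{d+1}$ centered at the origin. A subset of $\mathbb{S}^d$ is spherically convex if it is contained in an open hemisphere of $\mathbb{S}^d$ and, for any two of its points, it contains the spherical segment (the shorter unit circle arc) connecting them. A convex body in $\mathbb{S}^d$ (resp., $\mathbb{E}^d$) is a compact spherically convex (resp., compact convex) set with nonempty interior. A convex polytope in $\mathbb{S}^d$ (resp., $\mathbb{E}^d$) is a convex body that is the intersection of finitely many closed hemispheres (resp., closed halfspaces). An exposed face of a convex body in $\mathbb{S}^d$ (resp., $\mathbb{E}^d$) is the intersection of the body with a supporting $(d-1)$-dimensional greatsphere (resp., supporting hyperplane) of it; for a polytope these are exactly its nonempty proper faces. *)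

theory Defs
  imports "HOL-Analysis.Analysis"
begin

text \<open>The sphere \<open>S\<^sup>d\<close> is \<^term>\<open>sphere 0 1\<close> in a Euclidean space of dimension \<open>d + 1\<close>; interiors and
  boundaries of its subsets are taken in the subspace topology.\<close>

abbreviation sphere_interior :: "'a::euclidean_space set \<Rightarrow> 'a set" where
  "sphere_interior X \<equiv> (top_of_set (sphere 0 1)) interior_of X"

abbreviation sphere_frontier :: "'a::euclidean_space set \<Rightarrow> 'a set" where
  "sphere_frontier X \<equiv> (top_of_set (sphere 0 1)) frontier_of X"

definition open_hemisphere :: "'a::euclidean_space set \<Rightarrow> bool" where
  "open_hemisphere H \<longleftrightarrow> (\<exists>u. norm u = 1 \<and> H = {x \<in> sphere 0 1. u \<bullet> x < 0})"

definition closed_hemisphere :: "'a::euclidean_space set \<Rightarrow> bool" where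
  "closed_hemisphere H \<longleftrightarrow> (\<exists>u. norm u = 1 \<and> H = {x \<in> sphere 0 1. u \<bullet> x \<le> 0})"

text \<open>For non-antipodal unit vectors \<open>x\<close> and \<open>y\<close> the cone they span cuts the unit circle through
  them in the shorter arc.  Antipodal pairs never lie in a common open hemisphere.\<close>

definition spherical_segment :: "'a::euclidean_space \<Rightarrow> 'a \<Rightarrow> 'a set" where
  "spherical_segment x y = {a *\<^sub>R x + b *\<^sub>R y | a b. a \<ge> 0 \<and> b \<ge> 0} \<inter> sphere 0 1"

definition spherically_convex :: "'a::euclidean_space set \<Rightarrow> bool" where
  "spherically_convex X \<longleftrightarrow>
     (\<exists>H. open_hemisphere H \<and> X \<subseteq> H) \<and> (\<forall>x\<in>X. \<forall>y\<in>X. spherical_segment x y \<subseteq> X)"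

definition spherical_convex_body :: "'a::euclidean_space set \<Rightarrow> bool" where
  "spherical_convex_body K \<longleftrightarrow> compact K \<and> spherically_convex K \<and> sphere_interior K \<noteq> {}"

definition spherical_convex_polytope :: "'a::euclidean_space set \<Rightarrow> bool" where
  "spherical_convex_polytope P \<longleftrightarrow> spherical_convex_body P \<and>
     (\<exists>F. finite F \<and> (\<forall>h\<in>F. closed_hemisphere h) \<and> P = sphere 0 1 \<inter> \<Inter>F)"

definition spherical_exposed_face :: "'a::euclidean_space set \<Rightarrow> 'a set \<Rightarrow> bool" where
  "spherical_exposed_face F K \<longleftrightarrow> (\<exists>u. norm u = 1 \<and> (\<forall>x\<in>K. u \<bullet> x \<le> 0) \<and>
     K \<inter> {x \<in> sphere 0 1. u \<bullet> x = 0} \<noteq> {} \<and> F = K \<inter> {x \<in> sphere 0 1. u \<bullet> x = 0})"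

definition open_halfspace :: "'a::euclidean_space set \<Rightarrow> bool" where
  "open_halfspace H \<longleftrightarrow> (\<exists>a b. a \<noteq> 0 \<and> H = {x. a \<bullet> x < b})"

definition convex_body :: "'a::euclidean_space set \<Rightarrow> bool" where
  "convex_body K \<longleftrightarrow> compact K \<and> convex K \<and> interior K \<noteq> {}"

definition convex_polytope :: "'a::euclidean_space set \<Rightarrow> bool" where
  "convex_polytope P \<longleftrightarrow> convex_body P \<and> polyhedron P"

text \<open>Unlike \<^const>\<open>exposed_face_of\<close>, this excludes the empty set and the whole body, since the
  hyperplane has to be a genuine one that meets the body.\<close>

definition eucl_exposed_face :: "'a::euclidean_space set \<Rightarrow> 'a set \<Rightarrow> bool" where
  "eucl_exposed_face F K \<longleftrightarrow> (\<exists>a b. a \<noteq> 0 \<and> (\<forall>x\<in>K. a \<bullet> x \<le> b) \<and>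
     K \<inter> {x. a \<bullet> x = b} \<noteq> {} \<and> F = K \<inter> {x. a \<bullet> x = b})"

lemma eucl_exposed_face_iff:
  assumes "convex_body K"
  shows "eucl_exposed_face F K \<longleftrightarrow> F exposed_face_of K \<and> F \<noteq> {} \<and> F \<noteq> K"
proof
  assume "eucl_exposed_face F K"
  then obtain a b where a: "a \<noteq> 0" "\<forall>x\<in>K. a \<bullet> x \<le> b" "F \<noteq> {}" "F = K \<inter> {x. a \<bullet> x = b}"
    unfolding eucl_exposed_face_def by blast
  have "F exposed_face_of K"
    using a assms by (simp add: exposed_face_of_Int_supporting_hyperplane_le convex_body_def)
  moreover have "F \<noteq> K"
  proof
    assume "F = K"
    then have "interior K \<subseteq> interior {x. a \<bullet> x = b}"
      using a by (intro interior_mono) blast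
    then show False
      using assms a by (simp add: convex_body_def)
  qed
  ultimately show "F exposed_face_of K \<and> F \<noteq> {} \<and> F \<noteq> K"
    using a by blast
next
  assume F: "F exposed_face_of K \<and> F \<noteq> {} \<and> F \<noteq> K"
  then obtain a b where ab: "K \<subseteq> {x. a \<bullet> x \<le> b}" "F = K \<inter> {x. a \<bullet> x = b}"
    unfolding exposed_face_of_def by blast
  have "a \<noteq> 0"
    using F ab by auto
  then show "eucl_exposed_face F K"
    unfolding eucl_exposed_face_def using F ab by blast
qed

end

theory Submission imports Defs begin

text \<open>Both versions are statements about a pointed polyhedral cone: the cone over a spherical polytope,
  or the cone over \<open>P \<times> {1}\<close>.  For cones one argues by induction on the dimension.  Let \<open>v\<close> span an
  exposed ray and let \<open>x'\<close> solve the problem for the projection of the cone along \<open>v\<close>.  A point \<open>x\<close> very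
  close to \<open>v\<close> and projecting to \<open>x'\<close> lies on a hyperplane that separates \<open>v\<close> from all other
  generators, which takes care of all faces avoiding \<open>v\<close>.  The faces through \<open>v\<close> project to faces of
  the smaller cone; they are covered by the pulled back halfspaces, tilted slightly towards \<open>v\<close>.\<close>

section \<open>Covering the faces of a pointed polyhedral cone\<close>

text \<open>A generator is exposed if, after rescaling all generators into the hyperplane
  \<open>w \<bullet> y = 1\<close>, its norm is maximal.\<close>

lemma exposed_ray_exists:
  fixes f :: "'i \<Rightarrow> 'a::real_inner"
  assumes "finite I" "I \<noteq> {}" and pos: "\<And>i. i \<in> I \<Longrightarrow> 0 < w \<bullet> f i"
  obtains j w' where "j \<in> I" "w' \<bullet> f j = 0"
    "\<And>i. i \<in> I \<Longrightarrow> w' \<bullet> f i > 0 \<or> (\<exists>k>0. f i = k *\<^sub>R f j)"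
proof -
  define t where "t i = f i /\<^sub>R (w \<bullet> f i)" for i
  obtain j where j: "j \<in> I" and jmax: "\<And>i. i \<in> I \<Longrightarrow> t i \<bullet> t i \<le> t j \<bullet> t j"
    using arg_min_if_finite[OF assms(1,2), of "\<lambda>i. - (t i \<bullet> t i)"] that
    by (meson neg_less_iff_less linorder_not_less)
  have f: "f i = (w \<bullet> f i) *\<^sub>R t i" if "i \<in> I" for i
    using pos[OF that] by (simp add: t_def)
  have wt: "w \<bullet> t i = 1" if "i \<in> I" for i
    using pos[OF that] by (simp add: t_def)
  \<comment> \<open>On the slice \<open>w \<bullet> y = 1\<close> this functional equals
    \<open>t j \<bullet> t j - t j \<bullet> y\<close>: it cuts out the tangent at
    \<open>t j\<close> of the ball around 0 that has \<open>t j\<close> on its boundary and contains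
    every \<open>t i\<close>.\<close>
  define w' where "w' = (t j \<bullet> t j) *\<^sub>R w - t j"
  have wf: "w' \<bullet> f i = (w \<bullet> f i) * (t j \<bullet> t j - t j \<bullet> t i)" if "i \<in> I" for i
    by (subst f[OF that]) (simp add: w'_def inner_diff_left wt[OF that])
  show ?thesis
  proof (rule that[OF j])
    show "w' \<bullet> f j = 0" using wf[OF j] by simp
    fix i assume i: "i \<in> I"
    show "w' \<bullet> f i > 0 \<or> (\<exists>k>0. f i = k *\<^sub>R f j)"
    proof (cases "t i = t j")
      case True
      have "f i = ((w \<bullet> f i) / (w \<bullet> f j)) *\<^sub>R f j"
        by (subst f[OF i], subst True) (simp add: t_def divide_inverse)
      then show ?thesis using pos[OF i] pos[OF j] by (metis divide_pos_pos)
    next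
      case False
      \<comment> \<open>Strict convexity of the ball: by maximality the bracket that gets subtracted
        is nonnegative, which makes the other one positive.\<close>
      have "0 < (t j - t i) \<bullet> (t j - t i)" using False by simp
      also have "\<dots> = 2 * (t j \<bullet> t j - t j \<bullet> t i) - (t j \<bullet> t j - t i \<bullet> t i)"
        by (simp add: inner_diff_left inner_diff_right inner_commute)
      finally have "0 < t j \<bullet> t j - t j \<bullet> t i" using jmax[OF i] by (smt (verit))
      then show ?thesis using wf[OF i] pos[OF i] by simp
    qed
  qed
qed

text \<open>The generators form an indexed family rather than a set because projection may identify some
  of them.  A proper face of the cone consists of the generators on which a valid inequality
  \<open>u \<bullet> y \<le> 0\<close> is tight; empty faces are included, so \<open>A\<close> may contain \<open>0\<close>.\<close>

lemma cone_face_cover: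
  fixes f :: "'i \<Rightarrow> 'a::euclidean_space"
  assumes "finite I" and "\<And>i. i \<in> I \<Longrightarrow> 0 < w \<bullet> f i" and "dim (f ` I) \<le> n"
  shows "\<exists>c A. (\<forall>i\<in>I. 0 < c i) \<and> finite A \<and> card A \<le> n \<and>
      (\<forall>a\<in>A. a \<bullet> (\<Sum>i\<in>I. c i *\<^sub>R f i) = 0) \<and>
      (\<forall>u. (\<forall>i\<in>I. u \<bullet> f i \<le> 0) \<and> (\<exists>i\<in>I. u \<bullet> f i < 0) \<longrightarrow>
           (\<exists>a\<in>A. \<forall>i\<in>I. u \<bullet> f i = 0 \<longrightarrow> a \<bullet> f i < 0))"
  using assms
proof (induction n arbitrary: f I w)
  case 0
  then have "f ` I \<subseteq> {0}" by simp
  then have "I = {}" using "0.prems"(2) by fastforce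
  then show ?case by auto
next
  case (Suc n)
  show ?case
  proof (cases "I = {}")
    case True
    then show ?thesis by (intro exI[of _ "\<lambda>_. 1"] exI[of _ "{}"]) auto
  next
    case False
    obtain j w' where j: "j \<in> I" and w'j: "w' \<bullet> f j = 0"
      and ray: "\<And>i. i \<in> I \<Longrightarrow> w' \<bullet> f i > 0 \<or> (\<exists>k>0. f i = k *\<^sub>R f j)"
      by (rule exposed_ray_exists[OF Suc.prems(1) False Suc.prems(2)]) blast+
    define v where "v = f j"
    \<comment> \<open>\<open>T\<close> collects the generators off the ray of \<open>v\<close>; the
      others are positive multiples of \<open>v\<close>, and \<open>j\<close> is one of
      them.\<close>
    define T where "T = {i \<in> I. w' \<bullet> f i > 0}"
    have T: "finite T" "T \<subseteq> I" using Suc.prems(1) by (auto simp: T_def)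
    obtain k where k: "\<And>i. i \<in> I - T \<Longrightarrow> k i > 0" "\<And>i. i \<in> I - T \<Longrightarrow> f i = k i *\<^sub>R v"
    proof -
      have "\<forall>i\<in>I - T. \<exists>k>0. f i = k *\<^sub>R v" using ray by (auto simp: T_def v_def)
      then show ?thesis using that by metis
    qed
    have v0: "v \<noteq> 0" using Suc.prems(2)[OF j] by (auto simp: v_def)
    have w'v: "w' \<bullet> v = 0" using w'j by (simp add: v_def)
    have jT: "j \<in> I - T" using j w'j by (simp add: T_def)
    have uT: "\<exists>i\<in>T. u \<bullet> f i < 0" if "u \<bullet> v = 0" "\<exists>i\<in>I. u \<bullet> f i < 0" for u
      using that k(2) by force
    show ?thesis
    proof (cases "T = {}")
      case True
      have "u \<bullet> f i < 0" if u: "\<forall>i\<in>I. u \<bullet> f i \<le> 0" "\<exists>i\<in>I. u \<bullet> f i < 0" and i: "i \<in> I" for u i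
      proof -
        have "u \<bullet> v < 0" using uT[OF _ u(2)] True u(1) j by (fastforce simp: v_def)
        then show ?thesis using k[of i] i True by (simp add: mult_pos_neg)
      qed
      \<comment> \<open>On a single ray, a valid inequality that is strict somewhere is tight
        nowhere; the condition on \<open>a\<close> is vacuous and \<open>0\<close> serves as the
        normal.\<close>
      then show ?thesis
        by (intro exI[of _ "\<lambda>_. 1"] exI[of _ "{0}"]) fastforce
    next
      case Tne: False
      define q where "q = v \<bullet> v"
      have q: "q > 0" using v0 by (simp add: q_def)
      \<comment> \<open>Orthogonal projection along \<open>v\<close>. It is self-adjoint, so pulling
        a functional back along \<open>\<pi>\<close> just projects its normal vector.\<close>
      define \<pi> where "\<pi> y = y - ((y \<bullet> v) / q) *\<^sub>R v" for y
      have \<pi>_adj: "\<pi> y \<bullet> z = y \<bullet> \<pi> z" for y z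
        by (simp add: \<pi>_def inner_diff_left inner_diff_right inner_commute)
      have \<pi>_perp: "y \<bullet> \<pi> z = y \<bullet> z" if "y \<bullet> v = 0" for y z
        using that by (simp add: \<pi>_def inner_diff_right)
      have v\<pi>: "v \<bullet> \<pi> z = 0" for z
        using q by (simp add: \<pi>_def inner_diff_right inner_commute q_def)
      \<comment> \<open>The projections are orthogonal to \<open>v\<close>, so adjoining
        \<open>v\<close> to them raises the dimension by one without leaving the span of the
        generators.\<close>
      have "dim ((\<pi> \<circ> f) ` T) \<le> n"
      proof -
        have "span ((\<pi> \<circ> f) ` T) \<subseteq> {z. v \<bullet> z = 0}"
          by (rule span_minimal) (auto simp: v\<pi> subspace_hyperplane)
        then have "v \<notin> span ((\<pi> \<circ> f) ` T)" using v0 by auto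
        then have "Suc (dim ((\<pi> \<circ> f) ` T)) = dim (insert v ((\<pi> \<circ> f) ` T))"
          by (simp add: dim_insert)
        also have "\<dots> \<le> dim (f ` I)"
        proof (rule dim_mono)
          have v: "v \<in> span (f ` I)" using j by (auto simp: v_def intro: span_base)
          moreover have "\<pi> (f i) \<in> span (f ` I)" if "i \<in> T" for i
            unfolding \<pi>_def using that T(2) by (intro span_diff span_mul v span_base) auto
          ultimately show "insert v ((\<pi> \<circ> f) ` T) \<subseteq> span (f ` I)" by auto
        qed
        finally show ?thesis using Suc.prems(3) by simp
      qed
      \<comment> \<open>The projected cone is again pointed: \<open>w'\<close> vanishes at
        \<open>v\<close> and hence keeps its positive values on \<open>T\<close>.\<close>
      moreover have "0 < w' \<bullet> (\<pi> \<circ> f) i" if "i \<in> T" for i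
        using that \<pi>_perp[OF w'v] by (simp add: T_def)
      ultimately obtain c' A' where c': "\<forall>i\<in>T. 0 < c' i" and A': "finite A'" "card A' \<le> n"
        and A'x: "\<forall>a\<in>A'. a \<bullet> (\<Sum>i\<in>T. c' i *\<^sub>R (\<pi> \<circ> f) i) = 0"
        and A'u: "\<And>u. (\<forall>i\<in>T. u \<bullet> (\<pi> \<circ> f) i \<le> 0) \<Longrightarrow> (\<exists>i\<in>T. u \<bullet> (\<pi> \<circ> f) i < 0) \<Longrightarrow>
           (\<exists>a\<in>A'. \<forall>i\<in>T. u \<bullet> (\<pi> \<circ> f) i = 0 \<longrightarrow> a \<bullet> (\<pi> \<circ> f) i < 0)"
        using Suc.IH[OF T(1), of w' "\<pi> \<circ> f"] by blast
      define x' where "x' = (\<Sum>i\<in>T. c' i *\<^sub>R \<pi> (f i))"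
      \<comment> \<open>\<open>t\<close> is the multiple of \<open>v\<close> that the projection
        removes from the weighted sum over \<open>T\<close>.\<close>
      define t where "t = (\<Sum>i\<in>T. c' i * ((f i \<bullet> v) / q))"
      have x'_eq: "(\<Sum>i\<in>T. c' i *\<^sub>R f i) = x' + t *\<^sub>R v"
        by (simp add: x'_def t_def \<pi>_def scaleR_diff_right sum_subtractf scaleR_sum_left)
      define \<beta> where "\<beta> = w' \<bullet> x'"
      have \<beta>: "\<beta> > 0"
        unfolding \<beta>_def x'_def inner_sum_right using c' T(1) Tne
        by (intro sum_pos) (auto simp: \<pi>_perp[OF w'v] T_def)
      define K where "K = (\<Sum>i\<in>I - T. k i)"
      have K: "K > 0" unfolding K_def using k jT Suc.prems(1) by (intro sum_pos) auto
      \<comment> \<open>Large \<open>N\<close> puts \<open>x\<close> near the ray of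
        \<open>v\<close>. \<open>N > t\<close> keeps the weights on the ray positive, and the last
        bound is \<open>a0 \<bullet> f i < 0\<close> solved for \<open>N\<close>.\<close>
      have "\<forall>\<^sub>F N in at_top. N > 0 \<and> N > t \<and> (\<forall>i\<in>T. (\<beta> / q) * (v \<bullet> f i) / (w' \<bullet> f i) < N)"
        using T(1) by (intro eventually_conj eventually_gt_at_top eventually_ball_finite ballI)
      then obtain N where N: "N > 0" "N > t"
          "\<And>i. i \<in> T \<Longrightarrow> (\<beta> / q) * (v \<bullet> f i) / (w' \<bullet> f i) < N"
        using eventually_happens'[OF trivial_limit_at_top_linorder] by blast
      define x where "x = N *\<^sub>R v + x'"
      \<comment> \<open>The generators on the ray share the weight \<open>(N - t) / K\<close> and so
        contribute \<open>(N - t) *\<^sub>R v\<close>; with \<open>x' + t *\<^sub>R v\<close> from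
        \<open>T\<close> the sum becomes \<open>x\<close>.\<close>
      define c where "c i = (if i \<in> T then c' i else (N - t) / K)" for i
      have cpos: "\<forall>i\<in>I. 0 < c i" using c' N K by (auto simp: c_def)
      have xc: "(\<Sum>i\<in>I. c i *\<^sub>R f i) = x"
      proof -
        have "(\<Sum>i\<in>I. c i *\<^sub>R f i) = (\<Sum>i\<in>I - T. c i *\<^sub>R f i) + (\<Sum>i\<in>T. c i *\<^sub>R f i)"
          using Suc.prems(1) T by (simp add: sum.subset_diff)
        also have "(\<Sum>i\<in>T. c i *\<^sub>R f i) = x' + t *\<^sub>R v"
          unfolding x'_eq[symmetric] by (simp add: c_def)
        also have "(\<Sum>i\<in>I - T. c i *\<^sub>R f i) = (\<Sum>i\<in>I - T. (((N - t) / K) * k i) *\<^sub>R v)"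
          by (intro sum.cong) (auto simp: c_def k(2))
        also have "\<dots> = (((N - t) / K) * K) *\<^sub>R v"
          unfolding scaleR_sum_left[symmetric] K_def sum_distrib_left ..
        also have "\<dots> = (N - t) *\<^sub>R v"
          using K by simp
        finally show ?thesis by (simp add: x_def algebra_simps)
      qed
      \<comment> \<open>Solves \<open>a0 \<bullet> x = \<kappa> * N * q - \<beta> = 0\<close>. The
        resulting \<open>a0\<close> is positive at \<open>v\<close> and negative on
        \<open>T\<close>.\<close>
      define \<kappa> where "\<kappa> = \<beta> / (N * q)"
      have \<kappa>: "\<kappa> > 0" using \<beta> N q by (simp add: \<kappa>_def)
      define a0 where "a0 = \<kappa> *\<^sub>R v - w'"
      have vx': "v \<bullet> x' = 0" by (simp add: x'_def inner_sum_right v\<pi>)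
      have a0x: "a0 \<bullet> x = 0"
        using N q by (simp add: a0_def x_def inner_diff_left inner_add_right vx' w'v \<beta>_def \<kappa>_def flip: q_def)
      have a0v: "a0 \<bullet> v > 0" using \<kappa> q by (simp add: a0_def inner_diff_left w'v flip: q_def)
      have a0T: "a0 \<bullet> f i < 0" if "i \<in> T" for i
      proof -
        have "w' \<bullet> f i > 0" using that by (simp add: T_def)
        then show ?thesis using N(3)[OF that] N(1) q
          by (simp add: a0_def \<kappa>_def inner_diff_left field_simps)
      qed
      \<comment> \<open>Only finitely many strict inequalities have to survive the tilt, so a small
        positive \<open>\<tau>\<close> preserves them all.\<close>
      have "\<forall>\<^sub>F \<tau> in at_right 0. \<forall>a\<in>A'. \<forall>i\<in>T. a \<bullet> \<pi> (f i) < 0 \<longrightarrow> a \<bullet> \<pi> (f i) - \<tau> * (a0 \<bullet> f i) < 0"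
      proof (intro eventually_ball_finite ballI T A')
        fix a i
        have "((\<lambda>\<tau>. a \<bullet> \<pi> (f i) - \<tau> * (a0 \<bullet> f i)) \<longlongrightarrow> a \<bullet> \<pi> (f i) - 0 * (a0 \<bullet> f i)) (at_right 0)"
          by (intro tendsto_intros)
        then have "a \<bullet> \<pi> (f i) < 0 \<Longrightarrow> \<forall>\<^sub>F \<tau> in at_right 0. a \<bullet> \<pi> (f i) - \<tau> * (a0 \<bullet> f i) < 0"
          by (intro order_tendstoD) auto
        then show "\<forall>\<^sub>F \<tau> in at_right 0. a \<bullet> \<pi> (f i) < 0 \<longrightarrow> a \<bullet> \<pi> (f i) - \<tau> * (a0 \<bullet> f i) < 0"
          by (cases "a \<bullet> \<pi> (f i) < 0") auto
      qed
      then have "\<forall>\<^sub>F \<tau> in at_right 0. \<tau> > 0 \<and>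
          (\<forall>a\<in>A'. \<forall>i\<in>T. a \<bullet> \<pi> (f i) < 0 \<longrightarrow> a \<bullet> \<pi> (f i) - \<tau> * (a0 \<bullet> f i) < 0)"
        by (intro eventually_conj eventually_at_right_less)
      then obtain \<tau> where \<tau>: "\<tau> > 0"
        "\<And>a i. a \<in> A' \<Longrightarrow> i \<in> T \<Longrightarrow> a \<bullet> \<pi> (f i) < 0 \<Longrightarrow> a \<bullet> \<pi> (f i) - \<tau> * (a0 \<bullet> f i) < 0"
        using eventually_happens'[OF trivial_limit_at_right_real] by blast
      \<comment> \<open>\<open>\<pi> a\<close> vanishes at \<open>v\<close>; subtracting a little of
        \<open>a0\<close>, which is positive there, makes it negative on the whole ray. Both are
        orthogonal to \<open>x\<close>, hence so is the tilted normal.\<close>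
      define A where "A = insert a0 ((\<lambda>a. \<pi> a - \<tau> *\<^sub>R a0) ` A')"
      have "finite A" using A' by (simp add: A_def)
      moreover have "card A \<le> Suc n"
      proof -
        have "card A \<le> Suc (card ((\<lambda>a. \<pi> a - \<tau> *\<^sub>R a0) ` A'))"
          using A'(1) by (simp add: A_def card_insert_if)
        then show ?thesis
          using card_image_le[OF A'(1), of "\<lambda>a. \<pi> a - \<tau> *\<^sub>R a0"] A'(2) by linarith
      qed
      moreover have "a \<bullet> x = 0" if "a \<in> A" for a
      proof -
        have "\<pi> a \<bullet> x = a \<bullet> x'" for a
        proof -
          have "\<pi> v = 0" using q by (simp add: \<pi>_def flip: q_def)
          then have "\<pi> x = x'" using vx' q
            by (simp add: \<pi>_def x_def inner_add_left inner_add_right inner_commute flip: q_def)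
          then show ?thesis by (simp add: \<pi>_adj)
        qed
        then show ?thesis using that A'x a0x
          by (auto simp: A_def x'_def inner_diff_left)
      qed
      moreover have "\<exists>a\<in>A. \<forall>i\<in>I. u \<bullet> f i = 0 \<longrightarrow> a \<bullet> f i < 0"
        if u: "\<forall>i\<in>I. u \<bullet> f i \<le> 0" "\<exists>i\<in>I. u \<bullet> f i < 0" for u
      proof (cases "u \<bullet> v = 0")
        case False
        have "i \<in> T" if "i \<in> I" "u \<bullet> f i = 0" for i
          using that False k[of i] by force
        then show ?thesis using a0T by (auto simp: A_def)
      next
        case True
        \<comment> \<open>A face through \<open>v\<close> is a face of the projected cone: as
          \<open>u\<close> vanishes at \<open>v\<close>, projecting the generators does not change
          its values, and \<open>uT\<close> supplies a strictly negative one in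
          \<open>T\<close>.\<close>
        have "\<exists>a\<in>A'. \<forall>i\<in>T. u \<bullet> (\<pi> \<circ> f) i = 0 \<longrightarrow> a \<bullet> (\<pi> \<circ> f) i < 0"
          using u uT[OF True] T(2) by (intro A'u) (auto simp: \<pi>_perp[OF True])
        then obtain a where a: "a \<in> A'" "\<And>i. i \<in> T \<Longrightarrow> u \<bullet> f i = 0 \<Longrightarrow> a \<bullet> \<pi> (f i) < 0"
          by (auto simp: \<pi>_perp[OF True])
        have "(\<pi> a - \<tau> *\<^sub>R a0) \<bullet> f i < 0" if i: "i \<in> I" "u \<bullet> f i = 0" for i
        proof (cases "i \<in> T")
          case True
          then show ?thesis using \<tau>(2)[OF a(1) True] a(2) i by (simp add: inner_diff_left \<pi>_adj)
        next
          case False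
          then have "(\<pi> a - \<tau> *\<^sub>R a0) \<bullet> f i = - (\<tau> * k i * (a0 \<bullet> v))"
            using k[of i] i v\<pi>[of a] by (simp add: inner_diff_left inner_commute[of "\<pi> a" v])
          then show ?thesis using \<tau>(1) k[of i] a0v False i by simp
        qed
        then show ?thesis using a(1) by (auto simp: A_def)
      qed
      ultimately show ?thesis using cpos xc by blast
    qed
  qed
qed

section \<open>Faces of convex hulls and families of exact size\<close>

text \<open>A hull point on the supporting hyperplane is a convex combination of generators on that
  hyperplane. This carries a covering of tight generators over to whole faces.\<close>

lemma convex_hull_face_less:
  fixes a u y :: "'a::euclidean_space"
  assumes "finite S" "y \<in> convex hull S" "\<And>s. s \<in> S \<Longrightarrow> u \<bullet> s \<le> b" "u \<bullet> y = b"
    and "\<And>s. s \<in> S \<Longrightarrow> u \<bullet> s = b \<Longrightarrow> a \<bullet> s < \<beta>"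
  shows "a \<bullet> y < \<beta>"
proof -
  obtain l where l: "\<And>s. s \<in> S \<Longrightarrow> 0 \<le> l s" "sum l S = 1" "y = (\<Sum>s\<in>S. l s *\<^sub>R s)"
    using assms(1,2) by (auto simp: convex_hull_finite)
  \<comment> \<open>Used twice: for \<open>u\<close>, where the zero deficit of \<open>y\<close>
    forces zero weight off the face, and for \<open>a\<close>, where it gives the
    conclusion.\<close>
  have l_sum: "(\<Sum>s\<in>S. l s * (e - v \<bullet> s)) = e - v \<bullet> y" for e v
    using l(2) by (simp add: l(3) inner_sum_right right_diff_distrib sum_subtractf flip: sum_distrib_right)
  have face: "u \<bullet> s = b" if "s \<in> S" "l s \<noteq> 0" for s
    using l_sum[of b u] that l(1) assms(1,3,4) by (auto simp: sum_nonneg_eq_0_iff)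
  obtain s0 where s0: "s0 \<in> S" "l s0 \<noteq> 0"
    using l(2) by (metis sum.neutral zero_neq_one)
  have pos: "0 < l s * (\<beta> - a \<bullet> s)" if "s \<in> S" "l s \<noteq> 0" for s
    using that l(1)[OF that(1)] assms(5)[OF that(1) face[OF that]] by simp
  have "0 < (\<Sum>s\<in>S. l s * (\<beta> - a \<bullet> s))"
    using assms(1) s0(1) pos[OF s0]
  proof (rule sum_pos2)
    show "0 \<le> l s * (\<beta> - a \<bullet> s)" if "s \<in> S" for s
      using pos[OF that] by (cases "l s = 0") simp_all
  qed
  then show ?thesis by (simp add: l_sum)
qed

text \<open>The orthogonal complement of \<open>x\<close> has dimension at least 2 and so contains a
  unit circle. It supplies spare normals for filling up a family.\<close>

lemma infinite_unit_vectors_orthogonal: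
  fixes x :: "'a::euclidean_space"
  assumes "DIM('a) \<ge> 3"
  shows "infinite {a. norm a = 1 \<and> a \<bullet> x = 0}"
proof -
  have "dim {a. x \<bullet> a = 0} \<ge> 2"
    using assms by (cases "x = 0") (auto simp: dim_hyperplane)
  moreover obtain B where B: "B \<subseteq> {a. x \<bullet> a = 0}" "pairwise orthogonal B"
      "\<And>b. b \<in> B \<Longrightarrow> norm b = 1" "card B = dim {a. x \<bullet> a = 0}"
    using orthonormal_basis_subspace[OF subspace_hyperplane[of x]] by metis
  ultimately obtain E where "E \<subseteq> B" "card E = 2"
    by (metis obtain_subset_with_card_n)
  then obtain e1 e2 where e: "e1 \<in> B" "e2 \<in> B" "e1 \<noteq> e2"
    by (auto simp: card_2_iff)
  have e12: "e1 \<bullet> e2 = 0" "e1 \<bullet> e1 = 1" "e2 \<bullet> e2 = 1" "e1 \<bullet> x = 0" "e2 \<bullet> x = 0"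
    using B e by (auto simp: pairwise_def orthogonal_def inner_commute norm_eq_1)
  define g where "g t = cos t *\<^sub>R e1 + sin t *\<^sub>R e2" for t
  \<comment> \<open>The coordinate along \<open>e1\<close> tells the points apart, since the cosine
    is injective on \<open>{0..pi}\<close>.\<close>
  have "g t \<bullet> e1 = cos t" for t
    using e12 by (simp add: g_def inner_add_left inner_commute[of e2 e1])
  then have "inj_on g {0..pi}"
    by (intro inj_onI) (metis atLeastAtMost_iff cos_inj_pi)
  then have "infinite (g ` {0..pi})"
    using finite_imageD infinite_Icc pi_gt_zero by blast
  moreover have "norm (g t) = 1" for t
    using e12 sin_cos_squared_add2[of t]
    by (simp add: norm_eq_1 g_def inner_add_left inner_add_right inner_commute[of e2 e1] power2_eq_square)
  then have "g ` {0..pi} \<subseteq> {a. norm a = 1 \<and> a \<bullet> x = 0}"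
    using e12 by (auto simp: g_def inner_add_left)
  ultimately show ?thesis by (rule infinite_super[rotated])
qed

text \<open>The cone argument yields at most \<open>n\<close> members while exactly \<open>n\<close>
  are demanded; an infinite stock of admissible ones fills the gap.\<close>

lemma finite_extend_card:
  assumes "finite A" "A \<subseteq> X" "card A \<le> n" "infinite X"
  obtains B where "A \<subseteq> B" "B \<subseteq> X" "card B = n"
proof -
  obtain B where B: "finite B" "card B = n - card A" "B \<subseteq> X - A"
    using infinite_arbitrarily_large[OF Diff_infinite_finite[OF assms(1,4)]] by metis
  show thesis
  proof (rule that[of "A \<union> B"])
    show "card (A \<union> B) = n"
      using assms B by (subst card_Un_disjoint) auto
  qed (use assms B in auto)
qed

section \<open>Hemispheres and halfspaces with a prescribed boundary point\<close>

lemma sgn_mem_hemisphere: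
  fixes a z :: "'a::euclidean_space"
  assumes "a \<bullet> z < 0"
  shows "sgn z \<in> {y \<in> sphere 0 1. a \<bullet> y < 0}"
proof -
  have "z \<noteq> 0" using assms by auto
  then show ?thesis using assms by (simp add: norm_sgn sgn_div_norm mult_less_0_iff)
qed

text \<open>Pushing \<open>x\<close> in direction \<open>- a\<close> and normalising gives points of
  the hemisphere that converge to \<open>x\<close>.\<close>

lemma in_closure_hemisphere:
  fixes a x :: "'a::euclidean_space"
  assumes "a \<noteq> 0" "a \<bullet> x = 0" "norm x = 1"
  shows "x \<in> closure {y \<in> sphere 0 1. a \<bullet> y < 0}"
proof -
  let ?g = "\<lambda>t. sgn (x - t *\<^sub>R a)"
  have "(?g \<longlongrightarrow> sgn (x - 0 *\<^sub>R a)) (at_right 0)"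
    using assms(3) by (intro tendsto_intros) auto
  then have "(?g \<longlongrightarrow> x) (at_right 0)"
    using assms(3) by (simp add: sgn_div_norm)
  moreover have "\<forall>\<^sub>F t in at_right 0. ?g t \<in> closure {y \<in> sphere 0 1. a \<bullet> y < 0}"
  proof (rule eventually_mono[OF eventually_at_right_less])
    fix t :: real assume "0 < t"
    then have "a \<bullet> (x - t *\<^sub>R a) < 0"
      using assms by (simp add: inner_diff_right)
    then have "?g t \<in> {y \<in> sphere 0 1. a \<bullet> y < 0}"
      by (rule sgn_mem_hemisphere)
    then show "?g t \<in> closure {y \<in> sphere 0 1. a \<bullet> y < 0}"
      by (rule subsetD[OF closure_subset])
  qed
  ultimately show ?thesis
    by (intro Lim_in_closed_set[of _ ?g "at_right 0"]) auto
qed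

lemma hemisphere_frontier:
  fixes a x :: "'a::euclidean_space"
  assumes "a \<noteq> 0" "a \<bullet> x = 0" "norm x = 1"
  shows "x \<in> sphere_frontier {y \<in> sphere 0 1. a \<bullet> y < 0}"
proof -
  have "x \<notin> top_of_set (sphere 0 1) interior_of {y \<in> sphere 0 1. a \<bullet> y < 0}"
    using interior_of_subset[of "top_of_set (sphere 0 1)" "{y \<in> sphere 0 1. a \<bullet> y < 0}"] assms(2) by auto
  moreover have "sphere 0 1 \<inter> {y \<in> sphere 0 1. a \<bullet> y < 0} = {y \<in> sphere 0 1. a \<bullet> y < 0}"
    by blast
  ultimately show ?thesis
    using in_closure_hemisphere[OF assms] assms(3)
    by (simp add: frontier_of_def closure_of_subtopology)
qed

lemma open_hemisphere_nonzero:
  assumes "a \<noteq> 0"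
  shows "open_hemisphere {y \<in> sphere 0 1. a \<bullet> y < 0}"
  unfolding open_hemisphere_def
  using assms by (intro exI[of _ "sgn a"]) (auto simp: norm_sgn sgn_div_norm divide_less_0_iff mult_less_0_iff)

lemma infinite_hemispheres_through:
  fixes x :: "'a::euclidean_space"
  assumes "DIM('a) \<ge> 3" "norm x = 1"
  shows "infinite {H. open_hemisphere H \<and> x \<in> sphere_frontier H}"
proof -
  let ?h = "\<lambda>a. {y \<in> sphere 0 1. a \<bullet> y < 0}" and ?U = "{a. norm a = 1 \<and> a \<bullet> x = 0}"
  have "inj_on ?h ?U"
  proof (rule inj_onI, rule ccontr)
    fix a b assume a: "a \<in> ?U" and b: "b \<in> ?U" and eq: "?h a = ?h b" and "a \<noteq> b"
    have "0 < (a - b) \<bullet> (a - b)" using \<open>a \<noteq> b\<close> by simp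
    moreover have "a \<bullet> a = 1" "b \<bullet> b = 1" using a b by (simp_all add: norm_eq_1)
    ultimately have ab: "a \<bullet> b < 1"
      by (simp add: inner_diff_left inner_diff_right inner_commute)
    \<comment> \<open>\<open>sgn (a - b)\<close> separates the two hemispheres:
      \<open>b \<bullet> (a - b) = a \<bullet> b - 1 < 0\<close>, while
      \<open>a \<bullet> (a - b) = 1 - a \<bullet> b > 0\<close>.\<close>
    have "sgn (a - b) \<in> ?h b"
      using ab \<open>b \<bullet> b = 1\<close> by (intro sgn_mem_hemisphere) (simp add: inner_diff_right inner_commute)
    moreover have "a \<bullet> sgn (a - b) \<ge> 0"
      using ab \<open>a \<bullet> a = 1\<close> by (simp add: sgn_div_norm inner_diff_right)
    then have "sgn (a - b) \<notin> ?h a" by simp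
    ultimately show False using eq by blast
  qed
  then have "infinite (?h ` ?U)"
    using infinite_unit_vectors_orthogonal[OF assms(1)] finite_imageD by blast
  moreover have "?h ` ?U \<subseteq> {H. open_hemisphere H \<and> x \<in> sphere_frontier H}"
  proof safe
    fix a :: 'a assume a: "norm a = 1" "a \<bullet> x = 0"
    then have "a \<noteq> 0" by auto
    then show "open_hemisphere (?h a)" "x \<in> sphere_frontier (?h a)"
      using a assms(2) open_hemisphere_nonzero hemisphere_frontier by blast+
  qed
  ultimately show ?thesis by (rule infinite_super[rotated])
qed

lemma infinite_halfspaces_through:
  fixes x :: "'a::euclidean_space"
  assumes "DIM('a) \<ge> 3"
  shows "infinite {H. open_halfspace H \<and> x \<in> frontier H}"
proof -
  \<comment> \<open>Every unit vector is a possible normal here; the set has the shape of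
    \<open>infinite_unit_vectors_orthogonal\<close> at the point \<open>0\<close>.\<close>
  let ?h = "\<lambda>a. {y. a \<bullet> y < a \<bullet> x}" and ?U = "{a::'a. norm a = 1 \<and> a \<bullet> 0 = 0}"
  have "inj_on ?h ?U"
  proof (rule inj_onI, rule ccontr)
    fix a b assume a: "a \<in> ?U" and b: "b \<in> ?U" and eq: "?h a = ?h b" and "a \<noteq> b"
    have "0 < (a - b) \<bullet> (a - b)" using \<open>a \<noteq> b\<close> by simp
    moreover have "a \<bullet> a = 1" "b \<bullet> b = 1" using a b by (simp_all add: norm_eq_1)
    ultimately have "x + (a - b) \<in> ?h b" "x + (a - b) \<notin> ?h a"
      by (simp_all add: inner_diff_left inner_diff_right inner_add_right inner_commute)
    then show False using eq by blast
  qed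
  then have "infinite (?h ` ?U)"
    using infinite_unit_vectors_orthogonal[OF assms, of 0] finite_imageD by blast
  moreover have "?h ` ?U \<subseteq> {H. open_halfspace H \<and> x \<in> frontier H}"
  proof safe
    fix a :: 'a assume a: "norm a = 1"
    then have "a \<noteq> 0" by auto
    then show "open_halfspace (?h a)" "x \<in> frontier (?h a)"
      unfolding open_halfspace_def by (blast, simp add: frontier_halfspace_lt)
  qed
  ultimately show ?thesis by (rule infinite_super[rotated])
qed

section \<open>The spherical version\<close>

text \<open>Cutting the cone over \<open>P\<close> by \<open>w \<bullet> y = 1\<close> gives a
  bounded polyhedron, hence the hull of a finite \<open>S\<close>, and \<open>S\<close> generates
  the cone.\<close>

lemma spherical_polytope_cone:
  fixes P :: "'a::euclidean_space set"
  assumes "spherical_convex_polytope P"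
  obtains U w S where "finite U" "0 \<notin> U" "P = {y. norm y = 1 \<and> (\<forall>u\<in>U. u \<bullet> y \<le> 0)}"
    "\<forall>y\<in>P. 0 < w \<bullet> y" "finite S" "convex hull S = {y. w \<bullet> y = 1 \<and> (\<forall>u\<in>U. u \<bullet> y \<le> 0)}"
proof -
  obtain F where F: "finite F" "\<forall>h\<in>F. closed_hemisphere h" "P = sphere 0 1 \<inter> \<Inter>F"
    and "compact P" and "sphere_interior P \<noteq> {}" and "spherically_convex P"
    using assms by (auto simp: spherical_convex_polytope_def spherical_convex_body_def)
  then have "P \<noteq> {}" using interior_of_subset by fastforce
  obtain g where g: "\<And>h. h \<in> F \<Longrightarrow> norm (g h) = 1 \<and> h = {x \<in> sphere 0 1. g h \<bullet> x \<le> 0}"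
    using F(2) unfolding closed_hemisphere_def by metis
  define U where "U = g ` F"
  have U: "finite U" "0 \<notin> U" "P = {y. norm y = 1 \<and> (\<forall>u\<in>U. u \<bullet> y \<le> 0)}"
  proof -
    show "finite U" using F(1) by (simp add: U_def)
    show "0 \<notin> U" using g by (force simp: U_def)
    have "y \<in> h \<longleftrightarrow> g h \<bullet> y \<le> 0" if "norm y = 1" "h \<in> F" for y h
      using g[OF that(2)] that(1) by (metis (mono_tags, lifting) mem_Collect_eq mem_sphere_0)
    then have "y \<in> \<Inter>F \<longleftrightarrow> (\<forall>u\<in>U. u \<bullet> y \<le> 0)" if "norm y = 1" for y
      using that by (simp add: U_def)
    then show "P = {y. norm y = 1 \<and> (\<forall>u\<in>U. u \<bullet> y \<le> 0)}"
      unfolding F(3) by auto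
  qed
  obtain u where "\<forall>y\<in>P. u \<bullet> y < 0"
    using \<open>spherically_convex P\<close> unfolding spherically_convex_def open_hemisphere_def by blast
  then have w: "\<And>y. y \<in> P \<Longrightarrow> 0 < (- u) \<bullet> y" by auto
  define w where "w = - u"
  note w = w[folded w_def]
  \<comment> \<open>Compactness keeps \<open>w\<close> away from 0 on \<open>P\<close>; normalising
    a point of the slice into \<open>P\<close> then bounds its norm by
    \<open>1 / (w \<bullet> p)\<close>.\<close>
  obtain p where p: "p \<in> P" "\<And>y. y \<in> P \<Longrightarrow> w \<bullet> p \<le> w \<bullet> y"
    using continuous_attains_inf[OF \<open>compact P\<close> \<open>P \<noteq> {}\<close> continuous_on_inner[OF continuous_on_const continuous_on_id]]
    by blast
  define B where "B = {y. w \<bullet> y = 1 \<and> (\<forall>u\<in>U. u \<bullet> y \<le> 0)}"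
  have "bounded B"
  proof (rule boundedI)
    fix y assume y: "y \<in> B"
    then have "y \<noteq> 0" by (auto simp: B_def)
    then have "sgn y \<in> P"
      using y by (auto simp: U(3) B_def norm_sgn sgn_div_norm mult_le_0_iff)
    then have "w \<bullet> p \<le> 1 / norm y"
      using p(2)[of "sgn y"] y by (simp add: sgn_div_norm B_def divide_inverse)
    then show "norm y \<le> 1 / (w \<bullet> p)"
      using w[OF p(1)] \<open>y \<noteq> 0\<close> by (simp add: field_simps)
  qed
  moreover have "B = {y. w \<bullet> y = 1} \<inter> \<Inter>((\<lambda>u. {y. u \<bullet> y \<le> 0}) ` U)"
    by (auto simp: B_def)
  then have "polyhedron B"
    using U(1) by (auto intro!: polyhedron_Int polyhedron_hyperplane polyhedron_Inter polyhedron_halfspace_le)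
  ultimately have "polytope B"
    by (simp add: polytope_eq_bounded_polyhedron)
  then obtain S where "finite S" "B = convex hull S"
    by (auto simp: polytope_def)
  then show thesis
    using that[OF U, of w S] w B_def by simp
qed

text \<open>A greatsphere has empty interior: an interior point on it is a limit of points with
  \<open>u \<bullet> y < 0\<close>, some of which still lie in \<open>P\<close>.\<close>

lemma sphere_interior_imp_not_in_hyperplane:
  fixes P :: "'a::euclidean_space set"
  assumes "sphere_interior P \<noteq> {}" "u \<noteq> 0"
  obtains y where "y \<in> P" "u \<bullet> y \<noteq> 0"
proof -
  obtain p T where p: "p \<in> sphere 0 1" "p \<in> T" "open T" "sphere 0 1 \<inter> T \<subseteq> P"
    using assms(1) by (force simp: interior_of_def openin_open)
  show thesis
  proof (cases "u \<bullet> p = 0")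
    case True
    then have "p \<in> closure {y \<in> sphere 0 1. u \<bullet> y < 0}"
      using assms(2) p(1) by (intro in_closure_hemisphere) auto
    then have "T \<inter> {y \<in> sphere 0 1. u \<bullet> y < 0} \<noteq> {}"
      using p(2) open_Int_closure_eq_empty[OF p(3)] by blast
    then show thesis using p(4) that by force
  qed (use p that in blast)
qed

lemma spherical_face_cover:
  fixes P :: "'a::euclidean_space set"
  assumes "spherical_convex_polytope P" "DIM('a) \<ge> 3"
  shows "\<exists>x \<in> sphere_interior P. \<exists>\<H>. card \<H> = DIM('a) \<and>
              (\<forall>H\<in>\<H>. open_hemisphere H \<and> x \<in> sphere_frontier H) \<and>
              (\<forall>F. spherical_exposed_face F P \<longrightarrow> (\<exists>H\<in>\<H>. F \<subseteq> H))"
proof -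
  obtain U w S where U: "finite U" "0 \<notin> U" "P = {y. norm y = 1 \<and> (\<forall>u\<in>U. u \<bullet> y \<le> 0)}"
    and "\<forall>y\<in>P. 0 < w \<bullet> y" and S: "finite S"
    and hull: "convex hull S = {y. w \<bullet> y = 1 \<and> (\<forall>u\<in>U. u \<bullet> y \<le> 0)}"
    by (rule spherical_polytope_cone[OF assms(1)])
  then have w: "0 < w \<bullet> y" if "y \<in> P" for y using that by blast
  have int: "sphere_interior P \<noteq> {}"
    using assms(1) by (simp add: spherical_convex_polytope_def spherical_convex_body_def)
  have S_hull: "w \<bullet> s = 1" "\<And>u. u \<in> U \<Longrightarrow> u \<bullet> s \<le> 0" if "s \<in> S" for s
    using hull_subset[of S convex] that hull by auto
  \<comment> \<open>\<open>sgn\<close> maps \<open>S\<close> into \<open>P\<close>, and dividing by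
    \<open>w \<bullet> y\<close> maps \<open>P\<close> into the hull of \<open>S\<close>; signs of
    functionals can thus be moved between the two.\<close>
  have sgn_S: "sgn s \<in> P" if "s \<in> S" for s
    using S_hull[OF that] by (cases "s = 0") (auto simp: U(3) norm_sgn sgn_div_norm mult_le_0_iff)
  have P_hull: "y /\<^sub>R (w \<bullet> y) \<in> convex hull S" if "y \<in> P" for y
    using that w[OF that] by (auto simp: hull U(3) mult_le_0_iff)
  have le_S: "u \<bullet> s \<le> 0" if "\<And>y. y \<in> P \<Longrightarrow> u \<bullet> y \<le> 0" "s \<in> S" for u s
    using that(1)[OF sgn_S[OF that(2)]] S_hull(1)[OF that(2)]
    by (cases "s = 0") (auto simp: sgn_div_norm mult_le_0_iff)
  \<comment> \<open>The strictness condition of \<open>cone_face_cover\<close>: a valid inequality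
    tight on all of \<open>S\<close> would confine \<open>P\<close> to a greatsphere.\<close>
  have neg: "\<exists>s\<in>S. u \<bullet> s < 0" if u: "u \<noteq> 0" "\<And>y. y \<in> P \<Longrightarrow> u \<bullet> y \<le> 0" for u
  proof (rule ccontr)
    assume "\<not> ?thesis"
    then have "S \<subseteq> {y. u \<bullet> y = 0}" using le_S[OF u(2)] by force
    then have sub: "convex hull S \<subseteq> {y. u \<bullet> y = 0}"
      by (intro hull_minimal convex_hyperplane)
    obtain y where y: "y \<in> P" "u \<bullet> y \<noteq> 0"
      using sphere_interior_imp_not_in_hyperplane[OF int u(1)] by metis
    then show False using sub P_hull[OF y(1)] w[OF y(1)] by auto
  qed
  have "\<exists>c A. (\<forall>s\<in>S. 0 < c s) \<and> finite A \<and> card A \<le> DIM('a) \<and>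
      (\<forall>a\<in>A. a \<bullet> (\<Sum>s\<in>S. c s *\<^sub>R s) = 0) \<and>
      (\<forall>u. (\<forall>s\<in>S. u \<bullet> s \<le> 0) \<and> (\<exists>s\<in>S. u \<bullet> s < 0) \<longrightarrow>
           (\<exists>a\<in>A. \<forall>s\<in>S. u \<bullet> s = 0 \<longrightarrow> a \<bullet> s < 0))"
    by (rule cone_face_cover[OF S, of "w" "\<lambda>s. s"]) (simp add: S_hull(1), rule dim_subset_UNIV)
  then obtain c A where "\<forall>s\<in>S. 0 < c s" "finite A" "card A \<le> DIM('a)"
      and "\<forall>a\<in>A. a \<bullet> (\<Sum>s\<in>S. c s *\<^sub>R s) = 0"
      and face: "\<forall>u. (\<forall>s\<in>S. u \<bullet> s \<le> 0) \<and> (\<exists>s\<in>S. u \<bullet> s < 0) \<longrightarrow>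
           (\<exists>a\<in>A. \<forall>s\<in>S. u \<bullet> s = 0 \<longrightarrow> a \<bullet> s < 0)"
    by (elim exE conjE) (rule that)
  then have c: "\<And>s. s \<in> S \<Longrightarrow> 0 < c s" and A: "finite A" "card A \<le> DIM('a)"
      "\<And>a. a \<in> A \<Longrightarrow> a \<bullet> (\<Sum>s\<in>S. c s *\<^sub>R s) = 0"
    by simp_all
  have cover: "\<exists>a\<in>A. \<forall>s\<in>S. u \<bullet> s = 0 \<longrightarrow> a \<bullet> s < 0"
    if "\<forall>s\<in>S. u \<bullet> s \<le> 0" "\<exists>s\<in>S. u \<bullet> s < 0" for u
    using face that by (elim allE impE) (rule conjI)
  define x0 where "x0 = (\<Sum>s\<in>S. c s *\<^sub>R s)"
  have "S \<noteq> {}" using int interior_of_subset P_hull by fastforce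
  then have "0 < (\<Sum>s\<in>S. c s)" using S c by (intro sum_pos)
  then have "0 < w \<bullet> x0" using S_hull(1) by (simp add: x0_def inner_sum_right)
  then have x0: "x0 \<noteq> 0" by auto
  define x where "x = sgn x0"
  have x1: "norm x = 1" using x0 by (simp add: x_def norm_sgn)
  \<comment> \<open>All weights in \<open>x0\<close> are positive, so the one generator with
    \<open>u \<bullet> s < 0\<close> that \<open>neg\<close> provides already makes the sum
    negative.\<close>
  have Ux: "u \<bullet> x < 0" if uU: "u \<in> U" for u
  proof -
    obtain s where s: "s \<in> S" "u \<bullet> s < 0"
      using neg[of u] uU U by auto
    have "0 < (\<Sum>s\<in>S. c s * - (u \<bullet> s))"
      using S s(1) by (rule sum_pos2) (use s c[OF s(1)] in \<open>simp add: mult_pos_neg\<close>,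
          use S_hull(2)[OF _ uU] c in \<open>simp add: mult_le_0_iff less_imp_le\<close>)
    then have "u \<bullet> x0 < 0" by (simp add: x0_def inner_sum_right sum_negf)
    then show ?thesis using x0 by (simp add: x_def sgn_div_norm mult_less_0_iff)
  qed
  have "x \<in> sphere_interior P"
  proof -
    let ?T = "sphere 0 1 \<inter> (\<Inter>u\<in>U. {y. u \<bullet> y < 0})"
    have "openin (top_of_set (sphere 0 1)) ?T"
      using U(1) by (intro openin_open_Int open_INT ballI open_halfspace_lt)
    moreover have "?T \<subseteq> P" by (auto simp: U(3) less_imp_le)
    ultimately have "?T \<subseteq> sphere_interior P" by (intro interior_of_maximal)
    moreover have "x \<in> ?T" using x1 Ux by simp
    ultimately show ?thesis by (rule subsetD)
  qed
  moreover
  let ?h = "\<lambda>a. {y \<in> sphere 0 1. a \<bullet> y < 0}"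
  \<comment> \<open>\<open>A\<close> may contain \<open>0\<close>, which defines no hemisphere. It
    is dropped, and spare hemispheres through \<open>x\<close> then restore the exact
    number.\<close>
  have good: "?h ` (A - {0}) \<subseteq> {H. open_hemisphere H \<and> x \<in> sphere_frontier H}"
  proof (intro image_subsetI CollectI conjI)
    fix a assume a: "a \<in> A - {0}"
    then show "open_hemisphere (?h a)" by (intro open_hemisphere_nonzero) auto
    have "a \<bullet> x = 0" using A(3)[of a] a by (simp add: x_def sgn_div_norm x0_def)
    then show "x \<in> sphere_frontier (?h a)" using a x1 by (intro hemisphere_frontier) auto
  qed
  have "card (?h ` (A - {0})) \<le> DIM('a)"
    using card_image_le[of "A - {0}" ?h] card_Diff1_le[of A 0] A(1,2) by fastforce
  then obtain \<H> where \<H>: "?h ` (A - {0}) \<subseteq> \<H>"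
      "\<H> \<subseteq> {H. open_hemisphere H \<and> x \<in> sphere_frontier H}" "card \<H> = DIM('a)"
    using finite_extend_card[OF _ good _ infinite_hemispheres_through[OF assms(2) x1]] A(1)
    by blast
  have "\<exists>H\<in>\<H>. F \<subseteq> H" if F: "spherical_exposed_face F P" for F
  proof -
    obtain u where u: "norm u = 1" "\<And>y. y \<in> P \<Longrightarrow> u \<bullet> y \<le> 0" "F \<noteq> {}"
        "F = P \<inter> {x \<in> sphere 0 1. u \<bullet> x = 0}"
      using F unfolding spherical_exposed_face_def by metis
    then have "u \<noteq> 0" by auto
    then obtain a where a: "a \<in> A" "\<And>s. s \<in> S \<Longrightarrow> u \<bullet> s = 0 \<Longrightarrow> a \<bullet> s < 0"
      using cover[of u] le_S[OF u(2)] neg[OF _ u(2)] by blast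
    have F_neg: "a \<bullet> y < 0" if "y \<in> F" for y
    proof -
      have y: "y \<in> P" "u \<bullet> y = 0" using that u(4) by auto
      have "a \<bullet> (y /\<^sub>R (w \<bullet> y)) < 0"
        by (rule convex_hull_face_less[OF S P_hull[OF y(1)] le_S[OF u(2)]]) (use y a in auto)
      then show ?thesis using w[OF y(1)] by (simp add: mult_less_0_iff)
    qed
    \<comment> \<open>Exposed faces are nonempty and \<open>a\<close> is negative on
      \<open>F\<close>, so the normal found was not the dropped one.\<close>
    then have "a \<noteq> 0" using u(3) by auto
    moreover have "F \<subseteq> ?h a" using F_neg u(4) by auto
    ultimately show ?thesis using \<H>(1) a(1) by blast
  qed
  ultimately show ?thesis using \<H>(2,3) by blast
qed

section \<open>The Euclidean version\<close>

text \<open>Lifting \<open>s\<close> to \<open>(s, 1)\<close> turns affine functions on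
  \<open>Q\<close> into linear ones on the cone over \<open>Q \<times> {1}\<close>; the extra
  dimension accounts for the extra halfspace.\<close>

lemma euclidean_face_cover:
  fixes Q :: "'b::euclidean_space set"
  assumes "convex_polytope Q" "DIM('b) \<ge> 3"
  shows "\<exists>x \<in> interior Q. \<exists>\<H>. card \<H> = DIM('b) + 1 \<and>
              (\<forall>H\<in>\<H>. open_halfspace H \<and> x \<in> frontier H) \<and>
              (\<forall>F. eucl_exposed_face F Q \<longrightarrow> (\<exists>H\<in>\<H>. F \<subseteq> H))"
proof -
  have Q: "compact Q" "convex Q" "interior Q \<noteq> {}" "polyhedron Q"
    using assms(1) by (auto simp: convex_polytope_def convex_body_def)
  then have "polytope Q"
    by (simp add: polytope_eq_bounded_polyhedron compact_imp_bounded)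
  then obtain S where S: "finite S" and hull: "Q = convex hull S"
    by (auto simp: polytope_def)
  have SQ: "S \<subseteq> Q" unfolding hull by (rule hull_subset)
  have neg: "\<exists>s\<in>S. a \<bullet> s < b" if "a \<noteq> 0" "\<And>s. s \<in> S \<Longrightarrow> a \<bullet> s \<le> b" for a b
  proof (rule ccontr)
    assume "\<not> ?thesis"
    then have "S \<subseteq> {y. a \<bullet> y = b}" using that(2) by force
    then have "Q \<subseteq> {y. a \<bullet> y = b}"
      unfolding hull by (intro hull_minimal convex_hyperplane)
    then show False
      using interior_mono[of Q "{y. a \<bullet> y = b}"] Q(3) that(1) by simp
  qed
  define f where "f s = (s, 1::real)" for s :: 'b
  have "\<exists>c A. (\<forall>s\<in>S. 0 < c s) \<and> finite A \<and> card A \<le> DIM('b) + 1 \<and>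
      (\<forall>a\<in>A. a \<bullet> (\<Sum>s\<in>S. c s *\<^sub>R f s) = 0) \<and>
      (\<forall>u. (\<forall>s\<in>S. u \<bullet> f s \<le> 0) \<and> (\<exists>s\<in>S. u \<bullet> f s < 0) \<longrightarrow>
           (\<exists>a\<in>A. \<forall>s\<in>S. u \<bullet> f s = 0 \<longrightarrow> a \<bullet> f s < 0))"
    by (rule cone_face_cover[OF S, of "(0, 1)" "f"]) (simp add: f_def, use dim_subset_UNIV[of "f ` S"] in simp)
  then obtain c A where "\<forall>s\<in>S. 0 < c s" "finite A" "card A \<le> DIM('b) + 1"
      and "\<forall>a\<in>A. a \<bullet> (\<Sum>s\<in>S. c s *\<^sub>R f s) = 0"
      and face: "\<forall>u. (\<forall>s\<in>S. u \<bullet> f s \<le> 0) \<and> (\<exists>s\<in>S. u \<bullet> f s < 0) \<longrightarrow>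
           (\<exists>a\<in>A. \<forall>s\<in>S. u \<bullet> f s = 0 \<longrightarrow> a \<bullet> f s < 0)"
    by (elim exE conjE) (rule that)
  then have c: "\<And>s. s \<in> S \<Longrightarrow> 0 < c s" and A: "finite A" "card A \<le> DIM('b) + 1"
      "\<And>a. a \<in> A \<Longrightarrow> a \<bullet> (\<Sum>s\<in>S. c s *\<^sub>R f s) = 0"
    by simp_all
  have cover: "\<exists>a\<in>A. \<forall>s\<in>S. u \<bullet> f s = 0 \<longrightarrow> a \<bullet> f s < 0"
    if "\<forall>s\<in>S. u \<bullet> f s \<le> 0" "\<exists>s\<in>S. u \<bullet> f s < 0" for u
    using face that by (elim allE impE) (rule conjI)
  \<comment> \<open>Dividing by the total weight \<open>t\<close> brings the weighted sum back to
    height 1, so \<open>x\<close> is a convex combination of \<open>S\<close> with all weights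
    positive.\<close>
  define t where "t = (\<Sum>s\<in>S. c s)"
  define x where "x = (\<Sum>s\<in>S. (c s / t) *\<^sub>R s)"
  have "S \<noteq> {}" using Q(3) hull by auto
  then have t: "0 < t" unfolding t_def using S c by (intro sum_pos)
  have t1: "(\<Sum>s\<in>S. c s / t) = 1"
    using t by (simp add: t_def flip: sum_divide_distrib)
  have sum_f: "(\<Sum>s\<in>S. c s *\<^sub>R f s) = t *\<^sub>R (x, 1)"
    using t by (simp add: f_def x_def t_def sum_prod scaleR_sum_right)
  \<comment> \<open>A supporting hyperplane at \<open>x\<close> would have all generators on one
    side and, by \<open>neg\<close>, one strictly so; a positive average of them could not lie on
    it.\<close>
  have "x \<in> interior Q"
  proof (rule ccontr)
    assume "x \<notin> interior Q"
    then have "x \<notin> rel_interior Q" using Q(3) by (simp add: rel_interior_nonempty_interior)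
    moreover have "x \<in> Q"
      unfolding x_def using S Q(2) t1 t c SQ by (intro convex_sum) (auto simp: less_imp_le)
    ultimately obtain a where a: "a \<noteq> 0" "\<And>y. y \<in> closure Q \<Longrightarrow> a \<bullet> x \<le> a \<bullet> y"
      using supporting_hyperplane_relative_frontier[OF Q(2)] closure_subset[of Q] by (metis subsetD)
    have le: "(- a) \<bullet> s \<le> - (a \<bullet> x)" if "s \<in> S" for s
      using a(2)[of s] that SQ closure_subset[of Q] by auto
    then obtain s where s: "s \<in> S" "(- a) \<bullet> s < - (a \<bullet> x)"
      using neg[of "- a" "- (a \<bullet> x)"] a(1) by auto
    have "0 < (\<Sum>s\<in>S. (c s / t) * (a \<bullet> s - a \<bullet> x))"
      using S s(1) by (rule sum_pos2) (use s c t le in \<open>auto simp: less_imp_le\<close>)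
    also have "\<dots> = a \<bullet> x - (\<Sum>s\<in>S. c s / t) * (a \<bullet> x)"
      by (simp add: x_def right_diff_distrib sum_subtractf inner_sum_right sum_distrib_right)
    finally show False using t1 by simp
  qed
  moreover
  \<comment> \<open>A pair with first component \<open>0\<close> describes no halfspace and is left
    out.\<close>
  let ?h = "\<lambda>p. {y. fst p \<bullet> y < fst p \<bullet> x}" and ?A = "{p \<in> A. fst p \<noteq> 0}"
  have good: "?h ` ?A \<subseteq> {H. open_halfspace H \<and> x \<in> frontier H}"
    by (auto simp: open_halfspace_def frontier_halfspace_lt)
  have "finite ?A" using A(1) by simp
  have "card (?h ` ?A) \<le> DIM('b) + 1"
    using card_image_le[of ?A ?h] card_mono[of A ?A] A(1,2) by fastforce
  then obtain \<H> where \<H>: "?h ` ?A \<subseteq> \<H>"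
      "\<H> \<subseteq> {H. open_halfspace H \<and> x \<in> frontier H}" "card \<H> = DIM('b) + 1"
    using finite_extend_card[OF _ good _ infinite_halfspaces_through[OF assms(2)]] \<open>finite ?A\<close>
    by blast
  have "\<exists>H\<in>\<H>. F \<subseteq> H" if F: "eucl_exposed_face F Q" for F
  proof -
    obtain u b where u: "u \<noteq> 0" "\<And>y. y \<in> Q \<Longrightarrow> u \<bullet> y \<le> b" "F \<noteq> {}" "F = Q \<inter> {y. u \<bullet> y = b}"
      using F unfolding eucl_exposed_face_def by metis
    have uS: "u \<bullet> s \<le> b" if "s \<in> S" for s using u(2) SQ that by blast
    then have "\<exists>a\<in>A. \<forall>s\<in>S. (u, - b) \<bullet> f s = 0 \<longrightarrow> a \<bullet> f s < 0"
      using neg[OF u(1) uS] by (intro cover) (auto simp: f_def)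
    then obtain a \<alpha> where a: "(a, \<alpha>) \<in> A" "\<And>s. s \<in> S \<Longrightarrow> u \<bullet> s = b \<Longrightarrow> a \<bullet> s + \<alpha> < 0"
      by (force simp: f_def)
    \<comment> \<open>Orthogonality to \<open>t *\<^sub>R (x, 1)\<close> says that the affine
      function \<open>a \<bullet> y + \<alpha>\<close> vanishes at \<open>x\<close>.\<close>
    have "t * (a \<bullet> x + \<alpha>) = 0"
      using A(3)[OF a(1)] unfolding sum_f by (simp add: algebra_simps)
    then have ax: "\<alpha> = - (a \<bullet> x)" using t by simp
    have F_less: "a \<bullet> y < a \<bullet> x" if "y \<in> F" for y
      by (rule convex_hull_face_less[OF S _ uS]) (use that u(4) hull a(2) ax in force)+
    have "a \<noteq> 0" using F_less u(3) by auto
    then have "{y. a \<bullet> y < a \<bullet> x} \<in> \<H>"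
      using subsetD[OF \<H>(1) imageI[of "(a, \<alpha>)" ?A ?h]] a(1) by simp
    then show ?thesis using F_less by (intro bexI[of _ "{y. a \<bullet> y < a \<bullet> x}"]) auto
  qed
  ultimately show ?thesis using \<H>(2,3) by blast
qed

theorem corollary2:
  fixes d :: nat
    and P :: "'a::euclidean_space set"
    and Q :: "'b::euclidean_space set"
  assumes "d > 2"
    and "DIM('a) = d + 1"
    and "DIM('b) = d"
  shows "(spherical_convex_polytope P \<longrightarrow>
           (\<exists>x \<in> sphere_interior P. \<exists>\<H>. card \<H> = d + 1 \<and>
              (\<forall>H\<in>\<H>. open_hemisphere H \<and> x \<in> sphere_frontier H) \<and>
              (\<forall>F. spherical_exposed_face F P \<longrightarrow> (\<exists>H\<in>\<H>. F \<subseteq> H))))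
       \<and> (convex_polytope Q \<longrightarrow>
           (\<exists>x \<in> interior Q. \<exists>\<H>. card \<H> = d + 1 \<and>
              (\<forall>H\<in>\<H>. open_halfspace H \<and> x \<in> frontier H) \<and>
              (\<forall>F. eucl_exposed_face F Q \<longrightarrow> (\<exists>H\<in>\<H>. F \<subseteq> H))))"
  using assms spherical_face_cover[of P] euclidean_face_cover[of Q] by simp

end
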